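(* Let $n\ge2$ and $p\ge1$. For each $m\in\mathbb{N}_0$ let $h_m^p=\dim\mathcal{H}_m^p(\mathbb{C}^n)$ and let $\{e_{m,1},\dots,e_{m,h_m^p}\}$ be an orthonormal basis of $\mathcal{H}_m^p(\mathbb{C}^n)$ with respect to the inner product $$\langle f,g\rangle_{\widehat S_p}=\frac1p\int_S\sum_{j=0}^{p-1}f(e^{j\pi i/p}\zeta)\overline{g(e^{j\pi i/p}\zeta)}\,d\sigma(\zeta).$$ Let $a_{m,j}\in\mathbb{C}$ ($m\in\mathbb{N}_0$, $1\le j\le h_m^p$). Then the series $$f(x)=\sum_{m=0}^\infty\sum_{j=1}^{h_m^p}a_{m,j}e_{m,j}(x)$$ converges absolutely and uniformly on compact subsets of $\widehat B_p(R)$, where $$R^{-1}=\limsup_{m\to\infty}\left(\|a_m\|\right)^{1/m}\quad\text{and}\quad \|a_m\|^2=\sum_{j=1}^{h_m^p}|a_{m,j}|^2.$$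
   Context: $\mathbb{N}_0=\{0,1,2,\dots\}$. $S$ is the unit sphere in $\mathbb{R}^n$ and $\sigma$ the normalized surface measure on $S$; $\widehat S_p=\bigcup_{l=0}^{p-1}e^{l\pi i/p}S\subset\mathbb{C}^n$. $B(r)$ is the open ball in $\mathbb{R}^n$ of radius $r$ centred at the origin and $\widehat B_p(r)=\bigcup_{l=0}^{p-1}e^{l\pi i/p}B(r)\subset\mathbb{C}^n$. $\mathcal{H}_m^p(\mathbb{C}^n)$ is the space of homogeneous polynomials $q$ of degree $m$ on $\mathbb{C}^n$ with $\Delta^pq=0$, $\Delta=\sum_j\partial^2/\partial z_j^2$. Conventions: $R=\infty$ if the limsup is $0$ (with $B(\infty)=\mathbb{R}^n$), and $R=0$ (with $B(0)=\emptyset$) if the limsup is $\infty$. *)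

theory Defs
  imports "HOL-Analysis.Analysis" "HOL-Library.Function_Algebras"
begin

definition fun_scale :: "complex \<Rightarrow> ('a \<Rightarrow> complex) \<Rightarrow> 'a \<Rightarrow> complex" where
  "fun_scale c f = (\<lambda>z. c * f z)"

interpretation fun_space: vector_space "fun_scale :: complex \<Rightarrow> ('a \<Rightarrow> complex) \<Rightarrow> 'a \<Rightarrow> complex"
  by unfold_locales (auto simp: fun_scale_def fun_eq_iff algebra_simps)

definition homogeneous_poly :: "nat \<Rightarrow> (complex ^ 'n \<Rightarrow> complex) \<Rightarrow> bool" where
  "homogeneous_poly m q \<longleftrightarrow>
     (\<exists>c :: ('n \<Rightarrow> nat) \<Rightarrow> complex. \<forall>z.
        q z = (\<Sum>\<alpha> | (\<Sum>i\<in>UNIV. \<alpha> i) = m. c \<alpha> * (\<Prod>i\<in>UNIV. (z $ i) ^ \<alpha> i)))"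

text \<open>The sums above range over finite index sets, so no summand is silently dropped.\<close>

lemma finite_multi_indices: "finite {\<alpha> :: 'n::finite \<Rightarrow> nat. (\<Sum>i\<in>UNIV. \<alpha> i) = m}"
proof (rule finite_subset)
  show "{\<alpha>. (\<Sum>i\<in>UNIV. \<alpha> i) = m} \<subseteq> Pi\<^sub>E UNIV (\<lambda>_::'n. {..m})"
  proof
    fix \<alpha> :: "'n \<Rightarrow> nat"
    assume "\<alpha> \<in> {\<alpha>. (\<Sum>i\<in>UNIV. \<alpha> i) = m}"
    then have "\<alpha> i \<le> m" for i
      using member_le_sum[of i UNIV \<alpha>] by simp
    then show "\<alpha> \<in> Pi\<^sub>E UNIV (\<lambda>_. {..m})"
      by (simp add: PiE_UNIV_domain)
  qed
  show "finite (Pi\<^sub>E UNIV (\<lambda>_::'n. {..m}))"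
    by (rule finite_PiE) simp_all
qed

definition partial_deriv :: "'n \<Rightarrow> (complex ^ 'n \<Rightarrow> complex) \<Rightarrow> complex ^ 'n \<Rightarrow> complex" where
  "partial_deriv j f z = deriv (\<lambda>t. f (z + t *s axis j 1)) 0"

definition laplacian :: "(complex ^ 'n \<Rightarrow> complex) \<Rightarrow> complex ^ 'n \<Rightarrow> complex" where
  "laplacian f z = (\<Sum>j\<in>UNIV. partial_deriv j (partial_deriv j f) z)"

definition polyharmonic_space :: "nat \<Rightarrow> nat \<Rightarrow> (complex ^ 'n \<Rightarrow> complex) set" where
  "polyharmonic_space p m = {q. homogeneous_poly m q \<and> (laplacian ^^ p) q = (\<lambda>z. 0)}"

definition polyharmonic_dim :: "'n::finite itself \<Rightarrow> nat \<Rightarrow> nat \<Rightarrow> nat" where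
  "polyharmonic_dim _ p m = fun_space.dim (polyharmonic_space p m :: (complex ^ 'n \<Rightarrow> complex) set)"

definition complexify :: "real ^ 'n \<Rightarrow> complex ^ 'n" where
  "complexify x = (\<chi> i. complex_of_real (x $ i))"

text \<open>Normalized surface measure in polar coordinates: the measure of a Borel subset \<open>A\<close> of the
  unit sphere is the proportion of the volume of the unit ball lying in the cone over \<open>A\<close>
  (recall \<open>sgn x = x /\<^sub>R norm x\<close>; the origin is a null set).\<close>

definition sphere_measure :: "(real ^ 'n) measure" where
  "sphere_measure =
     restrict_space (distr (uniform_measure lborel (cball 0 1)) borel sgn) (sphere 0 1)"

definition sphere_inner ::
    "nat \<Rightarrow> (complex ^ 'n \<Rightarrow> complex) \<Rightarrow> (complex ^ 'n \<Rightarrow> complex) \<Rightarrow> complex" where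
  "sphere_inner p f g =
     1 / of_nat p * (\<integral>\<zeta>. (\<Sum>j<p. f (cis (real j * pi / real p) *s complexify \<zeta>) *
                           cnj (g (cis (real j * pi / real p) *s complexify \<zeta>))) \<partial>sphere_measure)"

definition is_orthonormal_basis ::
    "nat \<Rightarrow> (complex ^ 'n \<Rightarrow> complex) set \<Rightarrow> nat \<Rightarrow> (nat \<Rightarrow> complex ^ 'n \<Rightarrow> complex) \<Rightarrow> bool" where
  "is_orthonormal_basis p V h e \<longleftrightarrow>
     inj_on e {1..h} \<and> fun_space.independent (e ` {1..h}) \<and> fun_space.span (e ` {1..h}) = V \<and>
     (\<forall>i\<in>{1..h}. \<forall>j\<in>{1..h}. sphere_inner p (e i) (e j) = (if i = j then 1 else 0))"

text \<open>For an extended real radius, \<open>eball 0 r\<close> is empty for \<open>r = 0\<close> and the whole space for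
  \<open>r = \<infinity>\<close>.\<close>

definition rotated_ball :: "nat \<Rightarrow> ereal \<Rightarrow> (complex ^ 'n) set" where
  "rotated_ball p r =
     (\<Union>l<p. (\<lambda>x. cis (real l * pi / real p) *s complexify x) ` eball 0 r)"

definition coeff_norm :: "nat \<Rightarrow> (nat \<Rightarrow> complex) \<Rightarrow> real" where
  "coeff_norm h a = sqrt (\<Sum>j=1..h. (cmod (a j))\<^sup>2)"

end

theory Submission
  imports Defs "HOL-Probability.Probability_Measure"
begin

text \<open>The idea is that a harmonic or polyharmonic expansion behaves like a power series in \<open>norm x\<close>, because
  an orthonormal family of homogeneous polynomials of degree \<open>m\<close> is bounded on the sphere by a
  quantity that grows only polynomially in \<open>m\<close>. Explicitly, for every orthonormal family
  \<open>g\<^sub>1, \<dots>, g\<^sub>h\<close> of homogeneous polynomials of degree \<open>m\<close> in \<open>n\<close> variables and every point \<open>\<zeta>\<close> of the real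
  unit sphere,
  \<open>(\<Sum>j. \<bar>g\<^sub>j(\<zeta>)\<bar>\<^sup>2) \<le> (m + 1)\<^sup>n\<close> (lemma \<open>kernel_diag_le\<close>).

  To see this, take a complete orthonormal family \<open>f\<close> of the space of \<^emph>\<open>all\<close> homogeneous polynomials of
  degree \<open>m\<close>. The sum \<open>(\<Sum>i. \<bar>f\<^sub>i(\<zeta>)\<bar>\<^sup>2)\<close> is the largest value of \<open>\<bar>q(\<zeta>)\<bar>\<^sup>2\<close> among the \<open>q\<close> of norm one; it
  dominates the sum for \<open>g\<close> (lemma \<open>kernel_diag_le_of_spanning\<close>), and it does not depend on the
  choice of \<open>f\<close>. Since the space and the surface measure are invariant under rotations, the sum is
  a constant function of \<open>\<zeta>\<close>; its mean over the sphere is the number of members of \<open>f\<close> (lemma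
  \<open>kernel_diag_spanning\<close>), which is at most the number of monomials of degree \<open>m\<close>.
  This applies to the given bases because polyharmonic polynomials of degree \<open>m\<close> are among the
  homogeneous ones.

  The inner product over the rotated spheres agrees with the one over the real sphere, because
  for homogeneous \<open>f\<close> and \<open>g\<close> of the same degree the phases in \<open>f \<cdot> cnj g\<close> cancel. By homogeneity and
  Cauchy--Schwarz, the degree-\<open>m\<close> part of the series at a point \<open>x\<close> of the rotated ball is at most
  \<open>\<parallel>a\<^sub>m\<parallel> (m + 1)\<^sup>n (norm x)\<^sup>m\<close>. On a compact set \<open>norm x \<le> r < s < R\<close> for suitable \<open>r\<close> and \<open>s\<close>, and the
  definition of \<open>R\<close> bounds \<open>\<parallel>a\<^sub>m\<parallel>\<close> by \<open>s\<^bsup>-m\<^esup>\<close> for large \<open>m\<close>, so that the Weierstrass test applies.\<close>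

section \<open>Orthogonal invariance of Lebesgue measure\<close>

lemma nn_integral_lborel_translate:
  fixes f :: "'a::euclidean_space \<Rightarrow> ennreal"
  assumes [measurable]: "f \<in> borel_measurable borel"
  shows "(\<integral>\<^sup>+x. f (c + x) \<partial>lborel) = (\<integral>\<^sup>+x. f x \<partial>lborel)"
proof -
  have "(\<integral>\<^sup>+x. f x \<partial>lborel) = (\<integral>\<^sup>+x. f x \<partial>distr lborel borel ((+) c))"
    by (simp add: lborel_distr_plus)
  also have "\<dots> = (\<integral>\<^sup>+x. f (c + x) \<partial>lborel)"
    by (rule nn_integral_distr) auto
  finally show ?thesis ..
qed

lemma nn_integral_lborel_reflect:
  fixes f :: "'a::euclidean_space \<Rightarrow> ennreal"
  assumes [measurable]: "f \<in> borel_measurable borel"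
  shows "(\<integral>\<^sup>+x. f (c - x) \<partial>lborel) = (\<integral>\<^sup>+x. f x \<partial>lborel)"
proof -
  have "lborel = density (distr lborel borel (\<lambda>x. c + (-1) *\<^sub>R x)) (\<lambda>_. \<bar>-1::real\<bar> ^ DIM('a))"
    by (rule lborel_affine) simp
  also have "\<dots> = distr lborel borel (\<lambda>x. c - x)"
    by (simp add: density_1)
  finally have "(\<integral>\<^sup>+x. f x \<partial>lborel) = (\<integral>\<^sup>+x. f x \<partial>distr lborel borel (\<lambda>x. c - x))"
    by simp
  also have "\<dots> = (\<integral>\<^sup>+x. f (c - x) \<partial>lborel)"
    by (rule nn_integral_distr) auto
  finally show ?thesis ..
qed

text \<open>Lebesgue measure is, up to a factor, the only translation invariant measure, and the unit ball
  \<open>B\<close> fixes the factor because \<open>T\<close> maps it onto itself. The proof computes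
  \<open>\<lambda>(T\<^bsup>-1\<^esup> A) \<lambda>(B)\<close> as the double integral of \<open>1\<^sub>A(T x) 1\<^sub>B(T x + y)\<close>: integrating first over
  \<open>x\<close> and translating by \<open>T\<^bsup>-1\<^esup> y\<close> turns the integrand into \<open>1\<^sub>A(T x - y) 1\<^sub>B(T x)\<close>, whose integral
  over \<open>y\<close> is \<open>\<lambda>(A) 1\<^sub>B(x)\<close>.\<close>
lemma emeasure_orthogonal_vimage:
  fixes T :: "'a::euclidean_space \<Rightarrow> 'a"
  assumes T: "orthogonal_transformation T" and A[measurable]: "A \<in> sets borel"
  shows "emeasure lborel (T -` A) = emeasure lborel A"
proof -
  have lin: "linear T" and nrm: "\<And>x. norm (T x) = norm x" and "surj T"
    using T by (auto simp: orthogonal_transformation orthogonal_transformation_surj)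
  have cont: "continuous_on UNIV T"
    using lin by (simp add: linear_continuous_on linear_linear)
  then have [measurable]: "T \<in> borel_measurable borel"
    by (rule borel_measurable_continuous_onI)
  define B where "B = cball (0::'a) 1"
  have B[measurable]: "B \<in> sets borel" by (simp add: B_def)
  have TB: "T x \<in> B \<longleftrightarrow> x \<in> B" for x by (simp add: B_def nrm)
  have vim: "T -` A \<in> sets borel"
    using measurable_sets[of T borel borel A] by simp
  have "emeasure lborel (T -` A) * emeasure lborel B
      = (\<integral>\<^sup>+x. indicator A (T x) * emeasure lborel B \<partial>lborel)"
    using vim by (subst nn_integral_multc) (auto simp: indicator_vimage[symmetric])
  also have "\<dots> = (\<integral>\<^sup>+x. (\<integral>\<^sup>+y. indicator A (T x) * indicator B (T x + y) \<partial>lborel) \<partial>lborel)"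
    by (intro nn_integral_cong) (simp add: nn_integral_cmult nn_integral_lborel_translate)
  also have "\<dots> = (\<integral>\<^sup>+y. (\<integral>\<^sup>+x. indicator A (T x) * indicator B (T x + y) \<partial>lborel) \<partial>lborel)"
    by (rule lborel_pair.Fubini'[symmetric]) measurable
  also have "\<dots> = (\<integral>\<^sup>+y. (\<integral>\<^sup>+x. indicator A (T x - y) * indicator B x \<partial>lborel) \<partial>lborel)"
  proof (rule nn_integral_cong)
    fix y :: 'a
    obtain c where c: "T c = y" using \<open>surj T\<close> by (metis surjD)
    have "(\<integral>\<^sup>+x. indicator A (T x) * indicator B (T x + y) \<partial>lborel)
        = (\<integral>\<^sup>+x. indicator A (T x) * indicator B (T (c + x)) \<partial>lborel)"
      using lin c by (simp add: linear_add add.commute)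
    also have "\<dots> = (\<integral>\<^sup>+x. indicator A (T (c + x) - y) * indicator B (T (c + x)) \<partial>lborel)"
      using lin c by (simp add: linear_add)
    also have "\<dots> = (\<integral>\<^sup>+x. indicator A (T x - y) * indicator B (T x) \<partial>lborel)"
      by (rule nn_integral_lborel_translate) measurable
    finally show "(\<integral>\<^sup>+x. indicator A (T x) * indicator B (T x + y) \<partial>lborel)
        = (\<integral>\<^sup>+x. indicator A (T x - y) * indicator B x \<partial>lborel)"
      by (simp add: indicator_def TB)
  qed
  also have "\<dots> = (\<integral>\<^sup>+x. (\<integral>\<^sup>+y. indicator A (T x - y) * indicator B x \<partial>lborel) \<partial>lborel)"
    by (rule lborel_pair.Fubini') measurable
  also have "\<dots> = (\<integral>\<^sup>+x. emeasure lborel A * indicator B x \<partial>lborel)"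
    by (intro nn_integral_cong) (simp add: nn_integral_multc nn_integral_lborel_reflect)
  also have "\<dots> = emeasure lborel A * emeasure lborel B"
    by (simp add: nn_integral_cmult)
  finally have eq: "emeasure lborel (T -` A) * emeasure lborel B = emeasure lborel A * emeasure lborel B" .
  have "emeasure lborel B \<noteq> 0" "emeasure lborel B \<noteq> \<infinity>"
    by (auto simp: B_def emeasure_cball unit_ball_vol_def less_top[symmetric]
        ennreal_eq_0_iff not_le intro!: divide_pos_pos)
  then show ?thesis using eq
    by (metis ennreal_mult_divide_eq infinity_ennreal_def)
qed

section \<open>The normalized surface measure\<close>

abbreviation ball_measure :: "(real ^ 'n) measure" where
  "ball_measure \<equiv> uniform_measure lborel (cball 0 1)"

lemma emeasure_unit_cball:
  "emeasure lborel (cball (0::'a::euclidean_space) 1) \<noteq> 0"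
  "emeasure lborel (cball (0::'a::euclidean_space) 1) \<noteq> \<infinity>"
  by (auto simp: emeasure_cball ennreal_eq_0_iff not_le)

lemma AE_ball_measure_iff:
  "(AE x in ball_measure. P x) \<longleftrightarrow> (AE x in lborel. x \<in> cball (0 :: real ^ 'n) 1 \<longrightarrow> P x)"
  by (rule AE_uniform_measure) (use emeasure_unit_cball in \<open>auto simp: less_top[symmetric]\<close>)

lemma AE_ball_measure_sgn: "AE x in (ball_measure :: (real ^ 'n) measure). sgn x \<in> sphere 0 1"
proof -
  have "AE x in lborel. x \<noteq> (0 :: real ^ 'n)" by (rule AE_lborel_singleton)
  then show ?thesis
    unfolding AE_ball_measure_iff by eventually_elim (simp add: norm_sgn)
qed

lemma prob_space_ball_measure: "prob_space (ball_measure :: (real ^ 'n) measure)"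
  using emeasure_unit_cball by (intro prob_space_uniform_measure) auto

lemma sphere_in_borel [measurable]: "sphere (a :: 'a::real_normed_vector) r \<in> sets borel"
  by (rule borel_closed) (auto simp: sphere_def intro!: closed_Collect_eq continuous_intros)

lemma space_sphere_measure [simp]: "space (sphere_measure :: (real ^ 'n) measure) = sphere 0 1"
  by (simp add: sphere_measure_def space_restrict_space)

lemma borel_measurable_sphere_measure:
  "continuous_on UNIV f \<Longrightarrow> f \<in> borel_measurable (sphere_measure :: (real ^ 'n) measure)"
  unfolding sphere_measure_def
  by (intro measurable_restrict_space1) (simp add: borel_measurable_continuous_onI)

lemma prob_space_sphere_measure: "prob_space (sphere_measure :: (real ^ 'n) measure)"
proof
  interpret prob_space "ball_measure :: (real ^ 'n) measure" by (rule prob_space_ball_measure)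
  have "emeasure (sphere_measure :: (real ^ 'n) measure) (sphere 0 1)
      = emeasure ball_measure (sgn -` sphere (0 :: real ^ 'n) 1)"
    unfolding sphere_measure_def
    by (subst emeasure_restrict_space) (auto simp: emeasure_distr)
  also have "\<dots> = 1"
    using AE_ball_measure_sgn measurable_sets[OF borel_measurable_sgn sphere_in_borel[of 0 1]]
    by (subst emeasure_eq_1_AE) auto
  finally show "emeasure sphere_measure (space (sphere_measure :: (real ^ 'n) measure)) = 1" by simp
qed

lemma integral_sphere_measure:
  fixes f :: "real ^ 'n \<Rightarrow> 'b::{banach, second_countable_topology}"
  assumes [measurable]: "f \<in> borel_measurable borel"
  shows "(\<integral>\<zeta>. f \<zeta> \<partial>sphere_measure) = (\<integral>x. f (sgn x) \<partial>ball_measure)"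
proof -
  have "(\<integral>\<zeta>. f \<zeta> \<partial>sphere_measure) = (\<integral>x. indicator (sphere 0 1) (sgn x) *\<^sub>R f (sgn x) \<partial>ball_measure)"
  proof -
    have "(\<integral>\<zeta>. f \<zeta> \<partial>sphere_measure) = (\<integral>x. indicator (sphere 0 1) x *\<^sub>R f x \<partial>distr ball_measure borel sgn)"
      unfolding sphere_measure_def by (rule integral_restrict_space) simp
    also have "\<dots> = (\<integral>x. indicator (sphere 0 1) (sgn x) *\<^sub>R f (sgn x) \<partial>ball_measure)"
      by (rule integral_distr) (simp, measurable)
    finally show ?thesis .
  qed
  also have "\<dots> = (\<integral>x. f (sgn x) \<partial>ball_measure)"
  proof (rule integral_cong_AE)
    show "AE x in ball_measure. indicator (sphere 0 1) (sgn x) *\<^sub>R f (sgn x) = f (sgn x)"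
      using AE_ball_measure_sgn by eventually_elim simp
  qed measurable
  finally show ?thesis .
qed

lemma integrable_sphere_measure:
  fixes f :: "real ^ 'n \<Rightarrow> 'b::{banach, second_countable_topology}"
  assumes "continuous_on UNIV f"
  shows "integrable sphere_measure f"
proof -
  interpret prob_space "sphere_measure :: (real ^ 'n) measure" by (rule prob_space_sphere_measure)
  have "bounded (f ` sphere 0 1)"
    by (intro compact_imp_bounded compact_continuous_image continuous_on_subset[OF assms]) auto
  then obtain b where "\<forall>x\<in>sphere 0 1. norm (f x) \<le> b" by (auto simp: bounded_iff)
  then show ?thesis
    by (intro integrable_const_bound[where B = b] AE_I2 borel_measurable_sphere_measure assms) auto
qed

lemma distr_ball_measure_orthogonal:
  fixes T :: "real ^ 'n \<Rightarrow> real ^ 'n"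
  assumes T: "orthogonal_transformation T"
  shows "distr ball_measure borel T = ball_measure"
proof (rule measure_eqI)
  have [measurable]: "T \<in> borel_measurable borel"
    using T by (intro borel_measurable_continuous_onI linear_continuous_on)
      (simp add: orthogonal_transformation_linear linear_linear)
  fix A assume "A \<in> sets (distr ball_measure borel T)"
  then have A[measurable]: "A \<in> sets borel" by simp
  have vim: "T -` A \<in> sets borel"
    using measurable_sets[of T borel borel A] by simp
  have "cball 0 1 \<inter> T -` A = T -` (cball 0 1 \<inter> A)"
    using T by (auto simp: orthogonal_transformation)
  then have "emeasure lborel (cball 0 1 \<inter> T -` A) = emeasure lborel (cball 0 1 \<inter> A)"
    using T by (simp add: emeasure_orthogonal_vimage del: vimage_Int)
  then show "emeasure (distr ball_measure borel T) A = emeasure ball_measure A"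
    using vim by (simp add: emeasure_distr)
qed simp

lemma integral_sphere_measure_orthogonal:
  fixes f :: "real ^ 'n \<Rightarrow> 'b::{banach, second_countable_topology}" and T :: "real ^ 'n \<Rightarrow> real ^ 'n"
  assumes T: "orthogonal_transformation T" and f: "continuous_on UNIV f"
  shows "(\<integral>\<zeta>. f (T \<zeta>) \<partial>sphere_measure) = (\<integral>\<zeta>. f \<zeta> \<partial>sphere_measure)"
proof -
  have lin: "linear T" and nrm: "\<And>x. norm (T x) = norm x"
    using T by (auto simp: orthogonal_transformation)
  have [measurable]: "T \<in> borel_measurable borel" "f \<in> borel_measurable borel"
    using lin f by (auto intro!: borel_measurable_continuous_onI linear_continuous_on simp: linear_linear)
  have "(\<integral>\<zeta>. f (T \<zeta>) \<partial>sphere_measure) = (\<integral>x. f (T (sgn x)) \<partial>ball_measure)"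
    by (rule integral_sphere_measure) measurable
  also have "\<dots> = (\<integral>x. f (sgn (T x)) \<partial>ball_measure)"
    using lin nrm by (simp add: sgn_div_norm linear_scale)
  also have "\<dots> = (\<integral>x. f (sgn x) \<partial>distr ball_measure borel T)"
    by (rule integral_distr[symmetric]) auto
  also have "\<dots> = (\<integral>\<zeta>. f \<zeta> \<partial>sphere_measure)"
    by (simp add: distr_ball_measure_orthogonal[OF T] integral_sphere_measure)
  finally show ?thesis .
qed

text \<open>The surface measure has full support: if \<open>f\<close> is positive at a point of the sphere, then it is
  positive on an open cone segment around it, which has positive volume.\<close>
lemma integral_sphere_measure_eq_0D:
  fixes f :: "real ^ 'n \<Rightarrow> real"
  assumes f: "continuous_on UNIV f" and nonneg: "\<And>x. f x \<ge> 0"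
    and int: "(\<integral>\<zeta>. f \<zeta> \<partial>sphere_measure) = 0" and z: "norm z = 1"
  shows "f z = 0"
proof (rule ccontr)
  assume "f z \<noteq> 0"
  then have fz: "f z > 0" using nonneg[of z] by simp
  interpret prob_space "ball_measure :: (real ^ 'n) measure" by (rule prob_space_ball_measure)
  have [measurable]: "f \<in> borel_measurable borel"
    using f by (rule borel_measurable_continuous_onI)
  have "AE \<zeta> in sphere_measure. f \<zeta> = 0"
    using int nonneg integral_nonneg_eq_0_iff_AE[OF integrable_sphere_measure[OF f]] by simp
  then have "AE x in ball_measure. sgn x \<in> sphere 0 1 \<longrightarrow> f (sgn x) = 0"
    unfolding sphere_measure_def by (simp add: AE_restrict_space_iff AE_distr_iff)
  then have ae: "AE x in lborel. x \<in> cball 0 1 \<longrightarrow> f (sgn x) = 0"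
    using AE_ball_measure_sgn unfolding AE_ball_measure_iff by eventually_elim simp
  define W where "W = {x \<in> ball 0 1 - {0}. f (sgn x) \<in> {0<..}}"
  have W: "open W"
  proof -
    have "continuous_on (ball 0 1 - {0}) (\<lambda>x. f (sgn x))"
      by (intro continuous_on_compose2[OF f] continuous_intros) auto
    then have "open ((ball 0 1 - {0}) \<inter> (\<lambda>x. f (sgn x)) -` {0<..})"
      by (intro continuous_open_preimage) auto
    also have "(ball 0 1 - {0}) \<inter> (\<lambda>x. f (sgn x)) -` {0<..} = W" by (auto simp: W_def)
    finally show ?thesis .
  qed
  have "AE x in lborel. x \<notin> W" using ae by eventually_elim (auto simp: W_def)
  then have "W \<in> null_sets lborel"
    using W by (simp add: AE_iff_null_sets)
  then have "negligible W"
    by (simp add: negligible_iff_null_sets null_sets_completionI)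
  moreover have "(1/2) *\<^sub>R z \<in> W"
    using z fz by (auto simp: W_def sgn_scaleR sgn_div_norm)
  ultimately show False using open_not_negligible[OF W] by auto
qed

section \<open>Homogeneous polynomials\<close>

abbreviation multi_indices :: "'n itself \<Rightarrow> nat \<Rightarrow> ('n::finite \<Rightarrow> nat) set" where
  "multi_indices _ m \<equiv> {\<alpha>. (\<Sum>i\<in>UNIV. \<alpha> i) = m}"

definition monomial :: "('n::finite \<Rightarrow> nat) \<Rightarrow> complex ^ 'n \<Rightarrow> complex" where
  "monomial \<alpha> z = (\<Prod>i\<in>UNIV. (z $ i) ^ \<alpha> i)"

lemma card_multi_indices_le: "card (multi_indices TYPE('n::finite) m) \<le> (m + 1) ^ CARD('n)"
proof -
  have "card (multi_indices TYPE('n) m) \<le> card (Pi\<^sub>E (UNIV :: 'n set) (\<lambda>_. {..m}))"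
  proof (rule card_mono)
    show "multi_indices TYPE('n) m \<subseteq> Pi\<^sub>E UNIV (\<lambda>_. {..m})"
      by (auto simp: PiE_UNIV_domain intro: member_le_sum)
  qed (simp add: finite_PiE)
  then show ?thesis by (simp add: card_PiE)
qed

lemma homogeneous_polyE:
  assumes "homogeneous_poly m (q :: complex ^ 'n \<Rightarrow> complex)"
  obtains c where "q = (\<lambda>z. \<Sum>\<alpha>\<in>multi_indices TYPE('n) m. c \<alpha> * monomial \<alpha> z)"
  using assms unfolding homogeneous_poly_def monomial_def by blast

lemma homogeneous_polyI:
  fixes q :: "complex ^ 'n \<Rightarrow> complex"
  assumes "\<And>z. q z = (\<Sum>\<alpha>\<in>multi_indices TYPE('n) m. c \<alpha> * monomial \<alpha> z)"
  shows "homogeneous_poly m q"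
  using assms unfolding homogeneous_poly_def monomial_def by blast

lemma homogeneous_poly_0: "homogeneous_poly m (\<lambda>_. 0)"
  unfolding homogeneous_poly_def by (intro exI[of _ "\<lambda>_. 0"]) simp

lemma homogeneous_poly_add:
  "homogeneous_poly m f \<Longrightarrow> homogeneous_poly m g \<Longrightarrow> homogeneous_poly m (\<lambda>z. f z + g z)"
  by (elim homogeneous_polyE, rule_tac c = "\<lambda>\<alpha>. c \<alpha> + ca \<alpha>" in homogeneous_polyI)
    (simp add: distrib_right sum.distrib)

lemma homogeneous_poly_cmult: "homogeneous_poly m f \<Longrightarrow> homogeneous_poly m (\<lambda>z. c * f z)"
  by (elim homogeneous_polyE, rule_tac c = "\<lambda>\<alpha>. c * ca \<alpha>" in homogeneous_polyI)
    (simp add: sum_distrib_left mult.assoc)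

lemma homogeneous_poly_sum:
  "(\<And>i. i \<in> I \<Longrightarrow> homogeneous_poly m (f i)) \<Longrightarrow> homogeneous_poly m (\<lambda>z. \<Sum>i\<in>I. f i z)"
  by (induction I rule: infinite_finite_induct) (auto intro: homogeneous_poly_0 homogeneous_poly_add)

lemma homogeneous_poly_monomial:
  fixes \<alpha> :: "'n::finite \<Rightarrow> nat"
  assumes "(\<Sum>i\<in>UNIV. \<alpha> i) = m"
  shows "homogeneous_poly m (monomial \<alpha>)"
  unfolding homogeneous_poly_def monomial_def[symmetric]
  using assms by (intro exI[of _ "\<lambda>\<beta>. if \<beta> = \<alpha> then 1 else 0"])
    (simp add: if_distrib[of "\<lambda>c. c * _"] finite_multi_indices cong: if_cong)

lemma homogeneous_poly_mult:
  assumes "homogeneous_poly k f" "homogeneous_poly m g"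
  shows "homogeneous_poly (k + m) (\<lambda>z. f z * g z)"
proof -
  from assms obtain c d where
    fg: "f = (\<lambda>z. \<Sum>\<alpha>\<in>multi_indices TYPE('a) k. c \<alpha> * monomial \<alpha> z)"
        "g = (\<lambda>z. \<Sum>\<beta>\<in>multi_indices TYPE('a) m. d \<beta> * monomial \<beta> z)"
    by (elim homogeneous_polyE)
  have "(\<lambda>z. f z * g z) = (\<lambda>z. \<Sum>\<alpha>\<in>multi_indices TYPE('a) k. \<Sum>\<beta>\<in>multi_indices TYPE('a) m.
      (c \<alpha> * d \<beta>) * monomial (\<lambda>i. \<alpha> i + \<beta> i) z)"
    unfolding fg by (simp add: sum_product monomial_def power_add prod.distrib mult_ac)
  then show ?thesis
    by (auto intro!: homogeneous_poly_sum homogeneous_poly_cmult homogeneous_poly_monomial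
        simp: sum.distrib)
qed

lemma homogeneous_poly_1: "homogeneous_poly 0 (\<lambda>z :: complex ^ 'n. 1)"
  using homogeneous_poly_monomial[of "\<lambda>_::'n. 0" 0] by (simp add: monomial_def[abs_def])

lemma homogeneous_poly_power:
  "homogeneous_poly 1 f \<Longrightarrow> homogeneous_poly k (\<lambda>z. f z ^ k)"
proof (induction k)
  case (Suc k)
  then show ?case using homogeneous_poly_mult[of 1 f k "\<lambda>z. f z ^ k"] by simp
qed (simp add: homogeneous_poly_1)

lemma homogeneous_poly_prod:
  assumes "\<And>i. i \<in> I \<Longrightarrow> homogeneous_poly (d i) (f i)" "finite I"
  shows "homogeneous_poly (\<Sum>i\<in>I. d i) (\<lambda>z. \<Prod>i\<in>I. f i z)"
  using assms(2,1)
  by (induction I) (auto simp: homogeneous_poly_1 intro: homogeneous_poly_mult)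

lemma homogeneous_poly_coordinate: "homogeneous_poly 1 (\<lambda>z :: complex ^ 'n. z $ i)"
proof -
  define \<delta> :: "'n \<Rightarrow> nat" where "\<delta> j = (if j = i then 1 else 0)" for j
  have "(\<Sum>j\<in>UNIV. \<delta> j) = 1" by (simp add: \<delta>_def)
  then have "homogeneous_poly 1 (monomial \<delta>)" by (rule homogeneous_poly_monomial)
  moreover have "monomial \<delta> z = z $ i" for z
  proof -
    have "monomial \<delta> z = (\<Prod>j\<in>UNIV. if j = i then z $ j else 1)"
      unfolding monomial_def \<delta>_def by (rule prod.cong) auto
    then show ?thesis by simp
  qed
  ultimately show ?thesis by (metis (no_types, lifting) ext)
qed

text \<open>This makes the space of all homogeneous polynomials of degree \<open>m\<close> invariant under rotations.\<close>
lemma homogeneous_poly_linear_subst: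
  fixes A :: "complex ^ 'n ^ 'n"
  assumes "homogeneous_poly m q"
  shows "homogeneous_poly m (\<lambda>z. q (A *v z))"
proof -
  obtain c where q: "q = (\<lambda>z. \<Sum>\<alpha>\<in>multi_indices TYPE('n) m. c \<alpha> * monomial \<alpha> z)"
    using assms by (rule homogeneous_polyE)
  have lin: "homogeneous_poly 1 (\<lambda>z. (A *v z) $ i)" for i
    unfolding matrix_vector_mult_def
    by (simp, intro homogeneous_poly_sum homogeneous_poly_cmult)
       (use homogeneous_poly_coordinate in simp)
  have "homogeneous_poly m (\<lambda>z. monomial \<alpha> (A *v z))" if "\<alpha> \<in> multi_indices TYPE('n) m" for \<alpha>
    using homogeneous_poly_prod[of UNIV \<alpha> "\<lambda>i z. (A *v z) $ i ^ \<alpha> i"]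
      homogeneous_poly_power[OF lin] that by (simp add: monomial_def)
  then show ?thesis unfolding q by (intro homogeneous_poly_sum homogeneous_poly_cmult) auto
qed

lemma homogeneous_poly_scale:
  assumes "homogeneous_poly m q"
  shows "q (c *s z) = c ^ m * q z"
proof -
  obtain a where q: "q = (\<lambda>z. \<Sum>\<alpha>\<in>multi_indices TYPE('a) m. a \<alpha> * monomial \<alpha> z)"
    using assms by (rule homogeneous_polyE)
  have "monomial \<alpha> (c *s z) = c ^ m * monomial \<alpha> z" if "\<alpha> \<in> multi_indices TYPE('a) m" for \<alpha>
    using that by (auto simp: monomial_def power_mult_distrib prod.distrib power_sum)
  then show ?thesis unfolding q by (simp add: sum_distrib_left mult_ac)
qed

lemma continuous_on_complexify: "continuous_on UNIV (complexify :: real ^ 'n \<Rightarrow> complex ^ 'n)"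
  unfolding complexify_def by (intro continuous_intros)

lemma continuous_on_homogeneous_poly_complexify:
  fixes q :: "complex ^ 'n \<Rightarrow> complex"
  assumes "homogeneous_poly m q"
  shows "continuous_on UNIV (\<lambda>x. q (complexify x))"
proof -
  obtain c where q: "q = (\<lambda>z. \<Sum>\<alpha>\<in>multi_indices TYPE('n) m. c \<alpha> * monomial \<alpha> z)"
    using assms by (rule homogeneous_polyE)
  show ?thesis
    unfolding q monomial_def complexify_def by (simp, intro continuous_intros)
qed

lemma sum_fun_apply: "(\<Sum>i\<in>I. f i) x = (\<Sum>i\<in>I. f i x)"
  by (induction I rule: infinite_finite_induct) auto

lemma homogeneous_poly_in_span_monomials:
  fixes q :: "complex ^ 'n \<Rightarrow> complex"
  assumes "homogeneous_poly m q"
  shows "q \<in> fun_space.span (monomial ` multi_indices TYPE('n) m)"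
proof -
  obtain c where q: "q = (\<lambda>z. \<Sum>\<alpha>\<in>multi_indices TYPE('n) m. c \<alpha> * monomial \<alpha> z)"
    using assms by (rule homogeneous_polyE)
  have "q = (\<Sum>\<alpha>\<in>multi_indices TYPE('n) m. fun_scale (c \<alpha>) (monomial \<alpha>))"
    unfolding q by (simp add: fun_eq_iff fun_scale_def sum_fun_apply)
  also have "\<dots> \<in> fun_space.span (monomial ` multi_indices TYPE('n) m)"
    by (intro fun_space.span_sum fun_space.span_scale fun_space.span_base) auto
  finally show ?thesis .
qed

lemma complexify_linear:
  fixes T :: "real ^ 'n \<Rightarrow> real ^ 'n"
  assumes "linear T"
  obtains A :: "complex ^ 'n ^ 'n" where "\<And>x. complexify (T x) = A *v complexify x"
proof
  fix x
  have "T x = matrix T *v x" using assms by (simp add: matrix_vector_mul(1))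
  then show "complexify (T x) = (\<chi> i j. complex_of_real (matrix T $ i $ j)) *v complexify x"
    by (simp add: complexify_def matrix_vector_mult_def vec_eq_iff)
qed

section \<open>Orthonormal families of homogeneous polynomials\<close>

text \<open>On homogeneous polynomials of a common degree the phases in \<^const>\<open>sphere_inner\<close> cancel, so that
  it coincides with this inner product over the real sphere.\<close>
definition real_sphere_inner ::
    "(complex ^ 'n \<Rightarrow> complex) \<Rightarrow> (complex ^ 'n \<Rightarrow> complex) \<Rightarrow> complex" where
  "real_sphere_inner f g = (\<integral>\<zeta>. f (complexify \<zeta>) * cnj (g (complexify \<zeta>)) \<partial>sphere_measure)"

definition orthonormal_family :: "nat \<Rightarrow> 'i set \<Rightarrow> ('i \<Rightarrow> complex ^ 'n \<Rightarrow> complex) \<Rightarrow> bool" where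
  "orthonormal_family m I f \<longleftrightarrow> finite I \<and> (\<forall>i\<in>I. homogeneous_poly m (f i)) \<and>
     (\<forall>i\<in>I. \<forall>j\<in>I. real_sphere_inner (f i) (f j) = (if i = j then 1 else 0))"

lemma integrable_real_sphere_inner:
  assumes "homogeneous_poly m f" "homogeneous_poly m g"
  shows "integrable sphere_measure (\<lambda>\<zeta>. f (complexify \<zeta>) * cnj (g (complexify \<zeta>)))"
  by (intro integrable_sphere_measure continuous_intros
      continuous_on_homogeneous_poly_complexify[OF assms(1)]
      continuous_on_homogeneous_poly_complexify[OF assms(2)])

lemma real_sphere_inner_cong:
  assumes "\<And>\<zeta>. norm \<zeta> = 1 \<Longrightarrow> f (complexify \<zeta>) = f' (complexify \<zeta>)"
    and "\<And>\<zeta>. norm \<zeta> = 1 \<Longrightarrow> g (complexify \<zeta>) = g' (complexify \<zeta>)"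
  shows "real_sphere_inner f g = real_sphere_inner f' g'"
  unfolding real_sphere_inner_def using assms
  by (intro Bochner_Integration.integral_cong) auto

lemma real_sphere_inner_sum_left:
  assumes "\<And>i. i \<in> I \<Longrightarrow> homogeneous_poly m (f i)" "homogeneous_poly m g"
  shows "real_sphere_inner (\<lambda>z. \<Sum>i\<in>I. c i * f i z) g = (\<Sum>i\<in>I. c i * real_sphere_inner (f i) g)"
proof -
  have "real_sphere_inner (\<lambda>z. \<Sum>i\<in>I. c i * f i z) g
      = (\<integral>\<zeta>. (\<Sum>i\<in>I. c i * (f i (complexify \<zeta>) * cnj (g (complexify \<zeta>)))) \<partial>sphere_measure)"
    unfolding real_sphere_inner_def by (simp add: sum_distrib_right mult.assoc)
  also have "\<dots> = (\<Sum>i\<in>I. (\<integral>\<zeta>. c i * (f i (complexify \<zeta>) * cnj (g (complexify \<zeta>))) \<partial>sphere_measure))"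
    by (intro Bochner_Integration.integral_sum integrable_mult_right integrable_real_sphere_inner[of m] assms)
  finally show ?thesis by (simp add: real_sphere_inner_def)
qed

lemma real_sphere_inner_commute: "real_sphere_inner g f = cnj (real_sphere_inner f g)"
  unfolding real_sphere_inner_def
  by (simp add: mult.commute flip: Bochner_Integration.integral_cnj)

lemma real_sphere_inner_sum_right:
  assumes "\<And>i. i \<in> I \<Longrightarrow> homogeneous_poly m (f i)" "homogeneous_poly m g"
  shows "real_sphere_inner g (\<lambda>z. \<Sum>i\<in>I. c i * f i z) = (\<Sum>i\<in>I. cnj (c i) * real_sphere_inner g (f i))"
  by (subst real_sphere_inner_commute, subst real_sphere_inner_sum_left[OF assms])
    (simp_all add: real_sphere_inner_commute[of g])

lemma real_sphere_inner_self:
  assumes "homogeneous_poly m f"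
  shows "real_sphere_inner f f = of_real (\<integral>\<zeta>. (cmod (f (complexify \<zeta>)))\<^sup>2 \<partial>sphere_measure)"
  unfolding real_sphere_inner_def by (simp add: complex_norm_square[symmetric] flip: of_real_power)

lemma real_sphere_inner_self_eq_0D:
  assumes f: "homogeneous_poly m f" and 0: "real_sphere_inner f f = 0" and "norm \<zeta> = 1"
  shows "f (complexify \<zeta>) = 0"
proof -
  have "(\<integral>\<zeta>. (cmod (f (complexify \<zeta>)))\<^sup>2 \<partial>sphere_measure) = 0"
    using 0 by (simp add: real_sphere_inner_self[OF f])
  then have "(cmod (f (complexify \<zeta>)))\<^sup>2 = 0"
    by (rule integral_sphere_measure_eq_0D[rotated 2])
      (use assms in \<open>auto intro!: continuous_intros continuous_on_homogeneous_poly_complexify\<close>)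
  then show ?thesis by simp
qed

lemma real_sphere_inner_orthogonal:
  fixes f g :: "complex ^ 'n \<Rightarrow> complex" and T :: "real ^ 'n \<Rightarrow> real ^ 'n"
  assumes f: "homogeneous_poly m f" and g: "homogeneous_poly m g"
    and T: "orthogonal_transformation T" and A: "\<And>x. complexify (T x) = A *v complexify x"
  shows "real_sphere_inner (\<lambda>z. f (A *v z)) (\<lambda>z. g (A *v z)) = real_sphere_inner f g"
  unfolding real_sphere_inner_def A[symmetric]
  by (rule integral_sphere_measure_orthogonal[OF T])
    (intro continuous_intros continuous_on_homogeneous_poly_complexify[OF f]
      continuous_on_homogeneous_poly_complexify[OF g])

text \<open>An orthonormal family is linearly independent and lies in the span of the monomials. The
  number of monomials of degree \<open>m\<close> grows only polynomially in \<open>m\<close>, which is what keeps the radius of convergence unaffected.\<close>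
lemma card_orthonormal_family_le:
  fixes f :: "'i \<Rightarrow> complex ^ 'n \<Rightarrow> complex"
  assumes f: "orthonormal_family m I f"
  shows "card I \<le> (m + 1) ^ CARD('n)"
proof -
  have fin: "finite I" and hom: "\<And>i. i \<in> I \<Longrightarrow> homogeneous_poly m (f i)"
    and orth: "\<And>i j. i \<in> I \<Longrightarrow> j \<in> I \<Longrightarrow> real_sphere_inner (f i) (f j) = (if i = j then 1 else 0)"
    using f by (auto simp: orthonormal_family_def)
  have inj: "inj_on f I"
    by (rule inj_onI) (metis orth zero_neq_one)
  have "fun_space.independent (f ` I)"
  proof (rule fun_space.independent_if_scalars_zero)
    fix u x assume sum0: "(\<Sum>x\<in>f ` I. fun_scale (u x) x) = 0" and "x \<in> f ` I"
    then obtain j where j: "j \<in> I" "x = f j" by auto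
    have "(\<lambda>z. \<Sum>i\<in>I. u (f i) * f i z) = (\<lambda>z. 0)"
      using sum0 by (simp add: sum.reindex[OF inj] fun_eq_iff fun_scale_def sum_fun_apply)
    then have "real_sphere_inner (\<lambda>z. 0) (f j) = (\<Sum>i\<in>I. u (f i) * real_sphere_inner (f i) (f j))"
      using real_sphere_inner_sum_left[of I m f "f j" "\<lambda>i. u (f i)"] hom j by simp
    also have "\<dots> = u (f j)"
      using j fin by (simp add: orth if_distrib[of "\<lambda>c. _ * c"] cong: if_cong)
    finally show "u x = 0" by (simp add: j real_sphere_inner_def)
  qed (use fin in simp)
  then have "card (f ` I) \<le> card (monomial ` multi_indices TYPE('n) m)"
    using fun_space.independent_span_bound[of "monomial ` multi_indices TYPE('n) m" "f ` I"]
      hom by (auto simp: finite_multi_indices intro: homogeneous_poly_in_span_monomials)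
  also have "\<dots> \<le> card (multi_indices TYPE('n) m)"
    by (rule card_image_le) (rule finite_multi_indices)
  also have "\<dots> \<le> (m + 1) ^ CARD('n)" by (rule card_multi_indices_le)
  finally show ?thesis by (simp add: card_image[OF inj])
qed

section \<open>The diagonal of the reproducing kernel\<close>

text \<open>For an orthonormal basis \<open>f\<close> of a space of polynomials this is the value at \<open>(z, z)\<close> of the
  reproducing kernel of that space.\<close>
definition kernel_diag :: "'i set \<Rightarrow> ('i \<Rightarrow> complex ^ 'n \<Rightarrow> complex) \<Rightarrow> complex ^ 'n \<Rightarrow> real" where
  "kernel_diag I f z = (\<Sum>i\<in>I. (cmod (f i z))\<^sup>2)"

text \<open>Completeness of an orthonormal family, stated through the Fourier expansion. The expansion is
  required on the real sphere only, where the inner product controls the values of a polynomial directly.\<close>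
definition spans_on_sphere :: "nat \<Rightarrow> 'i set \<Rightarrow> ('i \<Rightarrow> complex ^ 'n \<Rightarrow> complex) \<Rightarrow> bool" where
  "spans_on_sphere m I f \<longleftrightarrow> (\<forall>q \<zeta>. homogeneous_poly m q \<longrightarrow> norm \<zeta> = 1 \<longrightarrow>
     q (complexify \<zeta>) = (\<Sum>i\<in>I. real_sphere_inner q (f i) * f i (complexify \<zeta>)))"

text \<open>An orthonormal family of greatest cardinality is complete: if the remainder \<open>r\<close> of the Fourier
  expansion of \<open>q\<close> had positive norm, then normalizing it would give one more member. Hence \<open>r\<close>
  has norm zero and vanishes on the sphere.\<close>
lemma ex_maximal_orthonormal_family:
  obtains k and f :: "nat \<Rightarrow> complex ^ 'n \<Rightarrow> complex"
  where "orthonormal_family m {..<k} f" "spans_on_sphere m {..<k} f"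
proof -
  define P where "P k \<longleftrightarrow> (\<exists>f :: nat \<Rightarrow> complex ^ 'n \<Rightarrow> complex. orthonormal_family m {..<k} f)" for k
  have "P 0" by (simp add: P_def orthonormal_family_def)
  moreover have bound: "\<And>k. P k \<Longrightarrow> k \<le> (m + 1) ^ CARD('n)"
    using card_orthonormal_family_le unfolding P_def by fastforce
  ultimately obtain k where k: "P k" "\<And>l. P l \<Longrightarrow> l \<le> k"
    using Nat.ex_has_greatest_nat[of P 0 "(m + 1) ^ CARD('n)"] by blast
  then obtain f :: "nat \<Rightarrow> complex ^ 'n \<Rightarrow> complex" where f: "orthonormal_family m {..<k} f"
    by (auto simp: P_def)
  have hom: "\<And>i. i < k \<Longrightarrow> homogeneous_poly m (f i)"
    and orth: "\<And>i j. i < k \<Longrightarrow> j < k \<Longrightarrow> real_sphere_inner (f i) (f j) = (if i = j then 1 else 0)"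
    using f by (auto simp: orthonormal_family_def)
  have "spans_on_sphere m {..<k} f"
    unfolding spans_on_sphere_def
  proof (intro allI impI)
    fix q :: "complex ^ 'n \<Rightarrow> complex" and \<zeta> :: "real ^ 'n"
    assume q: "homogeneous_poly m q" and \<zeta>: "norm \<zeta> = 1"
    \<comment> \<open>The index \<open>None\<close> stands for \<open>q\<close>, so that \<open>r\<close> is a single linear combination.\<close>
    define F where "F i = (case i of None \<Rightarrow> q | Some i \<Rightarrow> f i)" for i
    define C where "C i = (case i of None \<Rightarrow> 1 | Some i \<Rightarrow> - real_sphere_inner q (f i))" for i
    define J where "J = insert None (Some ` {..<k})"
    define r where "r = (\<lambda>z. \<Sum>i\<in>J. C i * F i z)"
    have r_eq: "r z = q z - (\<Sum>i<k. real_sphere_inner q (f i) * f i z)" for z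
      by (simp add: r_def J_def C_def F_def sum.reindex sum_negf)
    have homF: "\<And>i. i \<in> J \<Longrightarrow> homogeneous_poly m (F i)"
      using hom q by (auto simp: F_def J_def)
    have hom_r: "homogeneous_poly m r"
      unfolding r_def by (intro homogeneous_poly_sum homogeneous_poly_cmult homF)
    have r_orth: "real_sphere_inner r (f j) = 0" if "j < k" for j
    proof -
      have "real_sphere_inner r (f j) = (\<Sum>i\<in>J. C i * real_sphere_inner (F i) (f j))"
        unfolding r_def using homF hom[OF that] by (rule real_sphere_inner_sum_left)
      also have "\<dots> = real_sphere_inner q (f j) - (\<Sum>i<k. real_sphere_inner q (f i) * real_sphere_inner (f i) (f j))"
        by (simp add: J_def C_def F_def sum.reindex sum_negf)
      also have "\<dots> = 0"
        using that by (simp add: orth if_distrib[of "\<lambda>c. _ * c"] cong: if_cong)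
      finally show ?thesis .
    qed
    have "real_sphere_inner r r = 0"
    proof (rule ccontr)
      assume nz: "real_sphere_inner r r \<noteq> 0"
      define s where "s = (\<integral>\<zeta>. (cmod (r (complexify \<zeta>)))\<^sup>2 \<partial>sphere_measure)"
      have rr: "real_sphere_inner r r = of_real s"
        by (simp add: s_def real_sphere_inner_self[OF hom_r])
      have "s \<ge> 0" by (simp add: s_def)
      then have s: "s > 0" using nz rr by simp
      define g where "g = (\<lambda>z. complex_of_real (1 / sqrt s) * r z)"
      have g_left: "real_sphere_inner g h = complex_of_real (1 / sqrt s) * real_sphere_inner r h"
        if "homogeneous_poly m h" for h
        using real_sphere_inner_sum_left[of "{()}" m "\<lambda>_. r" h "\<lambda>_. complex_of_real (1 / sqrt s)"]
          hom_r that by (simp add: g_def)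
      have hom_g: "homogeneous_poly m g" unfolding g_def by (intro homogeneous_poly_cmult hom_r)
      have "real_sphere_inner r g = complex_of_real (1 / sqrt s) * real_sphere_inner r r"
        using g_left[OF hom_r] by (subst real_sphere_inner_commute) (simp add: rr)
      then have gg: "real_sphere_inner g g = 1"
        using s by (simp add: g_left[OF hom_g] rr flip: of_real_mult)
      have gf: "real_sphere_inner g (f j) = 0" if "j < k" for j
        using that by (simp add: g_left hom r_orth)
      then have fg: "real_sphere_inner (f j) g = 0" if "j < k" for j
        using that by (subst real_sphere_inner_commute) simp
      have "orthonormal_family m {..<Suc k} (f(k := g))"
        using hom orth hom_g gg gf fg by (auto simp: orthonormal_family_def less_Suc_eq)
      then have "P (Suc k)" by (auto simp: P_def)
      then show False using k(2) by fastforce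
    qed
    from real_sphere_inner_self_eq_0D[OF hom_r this \<zeta>]
    show "q (complexify \<zeta>) = (\<Sum>i\<in>{..<k}. real_sphere_inner q (f i) * f i (complexify \<zeta>))"
      by (simp add: r_eq)
  qed
  with f show thesis by (rule that)
qed

text \<open>Write \<open>K\<close> for the left-hand side and consider \<open>q = (\<Sum>j. cnj (g\<^sub>j(\<zeta>)) g\<^sub>j)\<close>, the kernel of the
  family \<open>g\<close> at \<open>\<zeta>\<close>. Both the value \<open>q(\<zeta>)\<close> and the squared norm of \<open>q\<close> equal \<open>K\<close>. Expanding \<open>q\<close> in the
  complete family \<open>f\<close>, Cauchy--Schwarz and Parseval's identity give \<open>K\<^sup>2 \<le> K \<cdot> kernel_diag I f \<zeta>\<close>.
  In particular, complete families all have the same diagonal on the sphere.\<close>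
lemma kernel_diag_le_of_spanning:
  assumes f: "orthonormal_family m I f" and span: "spans_on_sphere m I f"
    and g: "orthonormal_family m J g" and \<zeta>: "norm \<zeta> = 1"
  shows "kernel_diag J g (complexify \<zeta>) \<le> kernel_diag I f (complexify \<zeta>)"
proof -
  have homf: "\<And>i. i \<in> I \<Longrightarrow> homogeneous_poly m (f i)" and homg: "\<And>i. i \<in> J \<Longrightarrow> homogeneous_poly m (g i)"
    and orthg: "\<And>i j. i \<in> J \<Longrightarrow> j \<in> J \<Longrightarrow> real_sphere_inner (g i) (g j) = (if i = j then 1 else 0)"
    and fin: "finite I" "finite J"
    using f g by (auto simp: orthonormal_family_def)
  define z where "z = complexify \<zeta>"
  define K where "K = kernel_diag J g z"
  have K0: "K \<ge> 0" by (simp add: K_def kernel_diag_def sum_nonneg)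
  define q where "q = (\<lambda>w. \<Sum>j\<in>J. cnj (g j z) * g j w)"
  have homq: "homogeneous_poly m q"
    unfolding q_def by (intro homogeneous_poly_sum homogeneous_poly_cmult homg)
  have qz: "q z = of_real K"
    by (simp add: q_def K_def kernel_diag_def complex_norm_square mult.commute[of "cnj _"] del: of_real_power)
  have qg: "real_sphere_inner q (g j) = cnj (g j z)" if "j \<in> J" for j
  proof -
    have "real_sphere_inner q (g j) = (\<Sum>i\<in>J. cnj (g i z) * real_sphere_inner (g i) (g j))"
      unfolding q_def using homg homg[OF that] by (rule real_sphere_inner_sum_left)
    also have "\<dots> = cnj (g j z)"
      using that fin by (simp add: orthg if_distrib[of "\<lambda>c. _ * c"] cong: if_cong)
    finally show ?thesis .
  qed
  have "real_sphere_inner q q = (\<Sum>j\<in>J. cnj (cnj (g j z)) * real_sphere_inner q (g j))"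
    by (subst (2) q_def, rule real_sphere_inner_sum_right) (use homg homq in auto)
  also have "\<dots> = of_real K"
    by (simp add: qg K_def kernel_diag_def complex_norm_square del: of_real_power)
  finally have qq: "real_sphere_inner q q = of_real K" .
  define c where "c i = real_sphere_inner q (f i)" for i
  have exp: "q (complexify \<xi>) = (\<Sum>i\<in>I. c i * f i (complexify \<xi>))" if "norm \<xi> = 1" for \<xi>
    using span homq that unfolding spans_on_sphere_def c_def by blast
  have "real_sphere_inner q q = real_sphere_inner q (\<lambda>w. \<Sum>i\<in>I. c i * f i w)"
    by (rule real_sphere_inner_cong) (use exp in auto)
  also have "\<dots> = (\<Sum>i\<in>I. cnj (c i) * real_sphere_inner q (f i))"
    using homf homq by (rule real_sphere_inner_sum_right)
  also have "\<dots> = of_real (\<Sum>i\<in>I. (cmod (c i))\<^sup>2)"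
    by (simp add: complex_norm_square c_def mult.commute[of "cnj _"] del: of_real_power)
  finally have parseval: "(\<Sum>i\<in>I. (cmod (c i))\<^sup>2) = K"
    using qq of_real_eq_iff by metis
  have "K = cmod (q z)" using K0 by (simp add: qz)
  also have "\<dots> = cmod (\<Sum>i\<in>I. c i * f i z)" using exp[OF \<zeta>] by (simp add: z_def)
  also have "\<dots> \<le> (\<Sum>i\<in>I. cmod (c i) * cmod (f i z))"
    by (rule order_trans[OF norm_sum]) (simp add: norm_mult)
  finally have "K\<^sup>2 \<le> (\<Sum>i\<in>I. cmod (c i) * cmod (f i z))\<^sup>2"
    using K0 by (intro power_mono) auto
  also have "\<dots> \<le> (\<Sum>i\<in>I. (cmod (c i))\<^sup>2) * (\<Sum>i\<in>I. (cmod (f i z))\<^sup>2)"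
    by (rule Cauchy_Schwarz_ineq_sum)
  finally have "K * K \<le> K * kernel_diag I f z"
    unfolding parseval kernel_diag_def power2_eq_square[of K] .
  moreover have "kernel_diag I f z \<ge> 0" by (simp add: kernel_diag_def sum_nonneg)
  ultimately show ?thesis
    using K0 unfolding K_def[symmetric] z_def[symmetric]
    by (cases "K = 0") (auto simp: mult_le_cancel_left)
qed

lemma integral_kernel_diag:
  assumes f: "orthonormal_family m I f"
  shows "(\<integral>\<zeta>. kernel_diag I f (complexify \<zeta>) \<partial>sphere_measure) = card I"
proof -
  have hom: "\<And>i. i \<in> I \<Longrightarrow> homogeneous_poly m (f i)"
    and orth: "\<And>i. i \<in> I \<Longrightarrow> real_sphere_inner (f i) (f i) = 1"
    using f by (auto simp: orthonormal_family_def)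
  have "(\<integral>\<zeta>. kernel_diag I f (complexify \<zeta>) \<partial>sphere_measure)
      = (\<Sum>i\<in>I. (\<integral>\<zeta>. (cmod (f i (complexify \<zeta>)))\<^sup>2 \<partial>sphere_measure))"
    unfolding kernel_diag_def
    by (intro Bochner_Integration.integral_sum integrable_sphere_measure continuous_intros
        continuous_on_homogeneous_poly_complexify[OF hom])
  also have "\<dots> = (\<Sum>i\<in>I. 1)"
    using real_sphere_inner_self[OF hom] orth by (intro sum.cong refl) (metis of_real_eq_1_iff)
  finally show ?thesis by simp
qed

text \<open>A rotation carries a complete orthonormal family into another orthonormal family, so the
  preceding lemma shows that its diagonal is rotation invariant. As rotations act transitively
  on the sphere, the diagonal is constant there, and it equals its mean.\<close>
lemma kernel_diag_spanning:
  assumes f: "orthonormal_family m I f" and span: "spans_on_sphere m I f" and \<zeta>: "norm \<zeta> = 1"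
  shows "kernel_diag I f (complexify \<zeta>) = card I"
proof -
  interpret prob_space "sphere_measure :: (real ^ 'b) measure" by (rule prob_space_sphere_measure)
  have le: "kernel_diag I f (complexify \<eta>) \<le> kernel_diag I f (complexify \<xi>)"
    if norms: "norm \<eta> = 1" "norm \<xi> = 1" for \<eta> \<xi> :: "real ^ 'b"
  proof -
    obtain T where T: "orthogonal_transformation T" "T \<xi> = \<eta>"
      using norms by (metis orthogonal_transformation_exists)
    obtain A :: "complex ^ 'b ^ 'b" where A: "\<And>x. complexify (T x) = A *v complexify x"
      using complexify_linear[OF orthogonal_transformation_linear[OF T(1)]] by blast
    have "orthonormal_family m I (\<lambda>i z. f i (A *v z))"
      using f by (auto simp: orthonormal_family_def homogeneous_poly_linear_subst
          real_sphere_inner_orthogonal[of m, OF _ _ T(1) A])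
    from kernel_diag_le_of_spanning[OF f span this norms(2)]
    show ?thesis by (simp add: kernel_diag_def A[symmetric] T(2))
  qed
  have "real (card I) = (\<integral>\<xi>. kernel_diag I f (complexify \<xi>) \<partial>sphere_measure)"
    by (simp add: integral_kernel_diag[OF f])
  also have "\<dots> = (\<integral>\<xi>. kernel_diag I f (complexify \<zeta>) \<partial>(sphere_measure :: (real ^ 'b) measure))"
    by (rule Bochner_Integration.integral_cong) (use le \<zeta> in \<open>auto intro!: antisym\<close>)
  finally show ?thesis using prob_space by simp
qed

text \<open>The diagonal of a complete family of all homogeneous polynomials of degree \<open>m\<close> dominates that of
  \<open>g\<close> and is the constant size of that family.\<close>
lemma kernel_diag_le:
  fixes g :: "'i \<Rightarrow> complex ^ 'n \<Rightarrow> complex"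
  assumes g: "orthonormal_family m J g" and \<zeta>: "norm \<zeta> = 1"
  shows "kernel_diag J g (complexify \<zeta>) \<le> (real m + 1) ^ CARD('n)"
proof -
  obtain k and f :: "nat \<Rightarrow> complex ^ 'n \<Rightarrow> complex"
    where f: "orthonormal_family m {..<k} f" "spans_on_sphere m {..<k} f"
    by (rule ex_maximal_orthonormal_family)
  have "kernel_diag J g (complexify \<zeta>) \<le> kernel_diag {..<k} f (complexify \<zeta>)"
    by (rule kernel_diag_le_of_spanning[OF f g \<zeta>])
  also have "\<dots> = real k" using kernel_diag_spanning[OF f \<zeta>] by simp
  also have "\<dots> \<le> (real m + 1) ^ CARD('n)"
    using card_orthonormal_family_le[OF f(1)] by (simp flip: of_nat_le_iff[where 'a=real] add: add.commute)
  finally show ?thesis .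
qed

section \<open>From the sphere to rotated balls\<close>

lemma sphere_inner_eq_real_sphere_inner:
  assumes p: "p \<ge> 1" and f: "homogeneous_poly m f" and g: "homogeneous_poly m g"
  shows "sphere_inner p f g = real_sphere_inner f g"
proof -
  have rot: "f (c *s z) * cnj (g (c *s z)) = f z * cnj (g z)" if "cmod c = 1" for c z
  proof -
    have "f (c *s z) * cnj (g (c *s z)) = (c * cnj c) ^ m * (f z * cnj (g z))"
      by (simp add: homogeneous_poly_scale[OF f] homogeneous_poly_scale[OF g] power_mult_distrib mult_ac)
    also have "c * cnj c = 1" using that by (simp add: complex_norm_square[symmetric])
    finally show ?thesis by simp
  qed
  show ?thesis
    using p by (simp add: sphere_inner_def real_sphere_inner_def rot)
qed

lemma orthonormal_basis_imp_orthonormal_family: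
  assumes "p \<ge> 1" and "is_orthonormal_basis p (polyharmonic_space p m) h e"
  shows "orthonormal_family m {1..h} e"
proof -
  have hom: "homogeneous_poly m (e j)" if "j \<in> {1..h}" for j
  proof -
    have "e j \<in> fun_space.span (e ` {1..h})" using that by (intro fun_space.span_base) auto
    then show ?thesis using assms by (auto simp: is_orthonormal_basis_def polyharmonic_space_def)
  qed
  have "\<forall>i\<in>{1..h}. \<forall>j\<in>{1..h}. sphere_inner p (e i) (e j) = (if i = j then 1 else 0)"
    using assms(2) by (simp add: is_orthonormal_basis_def)
  then show ?thesis
    using hom by (simp add: orthonormal_family_def sphere_inner_eq_real_sphere_inner[OF assms(1) hom hom])
qed

lemma complexify_scaleR: "complexify (r *\<^sub>R x) = of_real r *s complexify x"
  by (simp add: complexify_def vec_eq_iff)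

lemma norm_complexify [simp]: "norm (complexify x) = norm x"
  by (simp add: complexify_def norm_vec_def L2_set_def)

lemma norm_vector_scalar_mult: "norm (c *s (z :: complex ^ 'n)) = cmod c * norm z"
  by (simp add: norm_vec_def norm_mult L2_set_right_distrib)

lemma kernel_diag_rotated_le:
  fixes g :: "'i \<Rightarrow> complex ^ 'n \<Rightarrow> complex"
  assumes g: "orthonormal_family m J g" and c: "cmod c = 1"
  shows "kernel_diag J g (c *s complexify y) \<le> (real m + 1) ^ CARD('n) * (norm y ^ m)\<^sup>2"
proof -
  obtain \<zeta> :: "real ^ 'n" where \<zeta>: "norm \<zeta> = 1" "y = norm y *\<^sub>R \<zeta>"
  proof (cases "y = 0")
    case True
    then show ?thesis using that[of "axis undefined 1"] by simp
  next
    case False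
    then show ?thesis using that[of "sgn y"] by (simp add: norm_sgn sgn_div_norm)
  qed
  have "c *s complexify y = (c * of_real (norm y)) *s complexify \<zeta>"
    by (subst \<zeta>(2)) (simp add: complexify_scaleR)
  then have "kernel_diag J g (c *s complexify y) = kernel_diag J g (complexify \<zeta>) * (norm y ^ m)\<^sup>2"
    using g c by (simp add: kernel_diag_def orthonormal_family_def homogeneous_poly_scale[of m]
        norm_mult norm_power power_mult_distrib sum_distrib_left mult.commute)
  also have "\<dots> \<le> (real m + 1) ^ CARD('n) * (norm y ^ m)\<^sup>2"
    by (intro mult_right_mono kernel_diag_le[OF g \<zeta>(1)]) simp
  finally show ?thesis .
qed

lemma sum_coeff_basis_le:
  fixes e :: "nat \<Rightarrow> complex ^ 'n \<Rightarrow> complex"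
  assumes e: "orthonormal_family m {1..h} e" and x: "x \<in> rotated_ball p R"
  shows "(\<Sum>j=1..h. cmod (a j * e j x)) \<le> coeff_norm h a * ((real m + 1) ^ CARD('n) * norm x ^ m)"
proof -
  obtain c y where c: "cmod c = 1" "x = c *s complexify y"
    using x unfolding rotated_ball_def by (force simp del: in_eball_iff)
  then have y: "norm y = norm x" by (simp add: norm_vector_scalar_mult)
  have "(\<Sum>j=1..h. cmod (a j * e j x)) = (\<Sum>j=1..h. \<bar>cmod (a j)\<bar> * \<bar>cmod (e j x)\<bar>)"
    by (simp add: norm_mult)
  also have "\<dots> \<le> coeff_norm h a * sqrt (kernel_diag {1..h} e x)"
    using L2_set_mult_ineq[of "\<lambda>j. cmod (a j)" "\<lambda>j. cmod (e j x)" "{1..h}"]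
    by (simp add: L2_set_def coeff_norm_def kernel_diag_def)
  also have "\<dots> \<le> coeff_norm h a * ((real m + 1) ^ CARD('n) * norm x ^ m)"
  proof (rule mult_left_mono)
    \<comment> \<open>Replacing the square root of \<open>(m + 1)\<^sup>n\<close> by \<open>(m + 1)\<^sup>n\<close> keeps the factor a polynomial in \<open>m\<close>.\<close>
    have "1 \<le> (real m + 1) ^ CARD('n)" by simp
    then have "(real m + 1) ^ CARD('n) \<le> ((real m + 1) ^ CARD('n))\<^sup>2"
      by (intro self_le_power) simp_all
    then have "(real m + 1) ^ CARD('n) * (norm x ^ m)\<^sup>2 \<le> ((real m + 1) ^ CARD('n) * norm x ^ m)\<^sup>2"
      unfolding power_mult_distrib[of _ "norm x ^ m"] by (intro mult_right_mono) simp_all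
    then have "kernel_diag {1..h} e x \<le> ((real m + 1) ^ CARD('n) * norm x ^ m)\<^sup>2"
      using kernel_diag_rotated_le[OF e c(1), of y] c(2) y by simp
    then show "sqrt (kernel_diag {1..h} e x) \<le> (real m + 1) ^ CARD('n) * norm x ^ m"
      by (intro real_le_lsqrt) simp_all
  qed (simp add: coeff_norm_def sum_nonneg)
  finally show ?thesis .
qed

lemma summable_poly_geometric:
  fixes q :: real
  assumes "0 \<le> q" "q < 1"
  shows "summable (\<lambda>m. (real m + 1) ^ k * q ^ m)"
proof -
  obtain c where c: "q < c" "c < 1" using dense[OF assms(2)] by blast
  have "(\<lambda>m. ((real m + 2) / (real m + 1)) ^ k * q) \<longlonglongrightarrow> 1 ^ k * q"
  proof (intro tendsto_mult tendsto_power tendsto_const)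
    have "(\<lambda>m. 1 + inverse (real (Suc m))) \<longlonglongrightarrow> 1 + 0"
      by (intro tendsto_intros LIMSEQ_inverse_real_of_nat)
    then show "(\<lambda>m. (real m + 2) / (real m + 1)) \<longlonglongrightarrow> 1"
      by (simp add: field_simps)
  qed
  then have "\<forall>\<^sub>F m in sequentially. ((real m + 2) / (real m + 1)) ^ k * q < c"
    using c by (intro order_tendstoD(2)) auto
  then obtain N where N: "\<And>m. m \<ge> N \<Longrightarrow> ((real m + 2) / (real m + 1)) ^ k * q \<le> c"
    by (auto simp: eventually_sequentially dest: less_imp_le)
  show ?thesis
  proof (rule summable_ratio_test[OF c(2)])
    fix m assume "m \<ge> N"
    have "norm ((real (Suc m) + 1) ^ k * q ^ Suc m)
        = (((real m + 2) / (real m + 1)) ^ k * q) * norm ((real m + 1) ^ k * q ^ m)"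
      using assms(1) by (simp add: abs_mult power_divide add.commute)
    also have "\<dots> \<le> c * norm ((real m + 1) ^ k * q ^ m)"
      using N[OF \<open>m \<ge> N\<close>] by (rule mult_right_mono) simp
    finally show "norm ((real (Suc m) + 1) ^ k * q ^ Suc m) \<le> c * norm ((real m + 1) ^ k * q ^ m)" .
  qed
qed

section \<open>Convergence of the series\<close>

lemma eventually_le_power_of_less_radius:
  fixes b :: "nat \<Rightarrow> real"
  assumes b: "\<And>m. b m \<ge> 0" and s: "s > 0"
    and less: "ereal s < inverse (limsup (\<lambda>m. ereal (root m (b m))))"
  shows "\<forall>\<^sub>F m in sequentially. b m \<le> (1 / s) ^ m"
proof -
  define L where "L = limsup (\<lambda>m. ereal (root m (b m)))"
  have "L \<ge> 0"
    unfolding L_def using b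
    by (intro le_Limsup) (auto intro!: always_eventually real_root_pos_pos_le)
  have "L < ereal (1 / s)"
    using less s \<open>L \<ge> 0\<close> unfolding L_def[symmetric]
    by (cases L) (auto simp: field_simps split: if_splits)
  then have "\<forall>\<^sub>F m in sequentially. ereal (root m (b m)) < ereal (1 / s)"
    unfolding L_def by (rule Limsup_lessD)
  with eventually_gt_at_top[of 0] show ?thesis
  proof eventually_elim
    case (elim m)
    then have "root m (b m) ^ m \<le> (1 / s) ^ m"
      using b by (intro power_mono) auto
    then show ?case using elim b by simp
  qed
qed

theorem theorem4:
  fixes p :: nat
    and e :: "nat \<Rightarrow> nat \<Rightarrow> complex ^ 'n \<Rightarrow> complex"
    and a :: "nat \<Rightarrow> nat \<Rightarrow> complex"
    and h :: "nat \<Rightarrow> nat"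
    and R :: ereal
  assumes n: "CARD('n) \<ge> 2"
    and p: "p \<ge> 1"
    and h_def: "h = polyharmonic_dim TYPE('n) p"
    and e: "\<And>m. is_orthonormal_basis p (polyharmonic_space p m) (h m) (e m)"
    and R_def: "R = inverse (limsup (\<lambda>m. ereal (root m (coeff_norm (h m) (a m)))))"
  shows "\<forall>K. compact K \<and> K \<subseteq> rotated_ball p R \<longrightarrow>
           (\<forall>x\<in>K. summable (\<lambda>m. \<Sum>j=1..h m. cmod (a m j * e m j x))) \<and>
           uniform_limit K (\<lambda>N x. \<Sum>m<N. \<Sum>j=1..h m. a m j * e m j x)
             (\<lambda>x. \<Sum>m. \<Sum>j=1..h m. a m j * e m j x) sequentially"
proof (intro allI impI, elim conjE)
  fix K :: "(complex ^ 'n) set"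
  assume K: "compact K" "K \<subseteq> rotated_ball p R"
  have norm_less: "ereal (norm x) < R" if "x \<in> K" for x
    using that K(2) by (auto simp: rotated_ball_def norm_vector_scalar_mult)
  show "(\<forall>x\<in>K. summable (\<lambda>m. \<Sum>j=1..h m. cmod (a m j * e m j x))) \<and>
      uniform_limit K (\<lambda>N x. \<Sum>m<N. \<Sum>j=1..h m. a m j * e m j x)
        (\<lambda>x. \<Sum>m. \<Sum>j=1..h m. a m j * e m j x) sequentially"
  proof (cases "K = {}")
    case True
    then show ?thesis by simp
  next
    case False
    then obtain x0 where x0: "x0 \<in> K" "\<And>x. x \<in> K \<Longrightarrow> norm x \<le> norm x0"
      using continuous_attains_sup[OF K(1) False, of norm] by (auto intro: continuous_intros)
    define r where "r = norm x0"
    have r0: "r \<ge> 0" by (simp add: r_def)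
    obtain s where s: "r < s" "ereal s < R"
      using ereal_dense2[OF norm_less[OF x0(1)]] by (auto simp: r_def)
    have s0: "s > 0" using r0 s(1) by simp
    have ev: "\<forall>\<^sub>F m in sequentially. coeff_norm (h m) (a m) \<le> (1 / s) ^ m"
      using s(2) s0 unfolding R_def
      by (intro eventually_le_power_of_less_radius) (auto simp: coeff_norm_def sum_nonneg)
    define M where "M m = (real m + 1) ^ CARD('n) * (r / s) ^ m" for m
    have M: "summable M"
      unfolding M_def using r0 s(1) s0 by (intro summable_poly_geometric) auto
    have bound: "\<forall>\<^sub>F m in sequentially. \<forall>x\<in>K. (\<Sum>j=1..h m. cmod (a m j * e m j x)) \<le> M m"
      using ev
    proof eventually_elim
      case (elim m)
      show ?case
      proof
        fix x assume x: "x \<in> K"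
        have "(\<Sum>j=1..h m. cmod (a m j * e m j x))
            \<le> coeff_norm (h m) (a m) * ((real m + 1) ^ CARD('n) * norm x ^ m)"
          using x K(2) by (intro sum_coeff_basis_le orthonormal_basis_imp_orthonormal_family[OF p e]) auto
        also have "\<dots> \<le> (1 / s) ^ m * ((real m + 1) ^ CARD('n) * r ^ m)"
          using elim x0(2)[OF x] s0 by (intro mult_mono power_mono) (auto simp: r_def)
        also have "\<dots> = M m" by (simp add: M_def power_divide)
        finally show "(\<Sum>j=1..h m. cmod (a m j * e m j x)) \<le> M m" .
      qed
    qed
    show ?thesis
    proof (intro conjI ballI)
      fix x assume "x \<in> K"
      then have "\<forall>\<^sub>F m in sequentially. norm (\<Sum>j=1..h m. cmod (a m j * e m j x)) \<le> M m"
        using bound by (auto elim!: eventually_mono simp: sum_nonneg)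
      then show "summable (\<lambda>m. \<Sum>j=1..h m. cmod (a m j * e m j x))"
        using M by (rule summable_comparison_test_ev)
    next
      show "uniform_limit K (\<lambda>N x. \<Sum>m<N. \<Sum>j=1..h m. a m j * e m j x)
          (\<lambda>x. \<Sum>m. \<Sum>j=1..h m. a m j * e m j x) sequentially"
      proof (rule Weierstrass_m_test_ev[OF _ M])
        show "\<forall>\<^sub>F m in sequentially. \<forall>x\<in>K. norm (\<Sum>j=1..h m. a m j * e m j x) \<le> M m"
          using bound by eventually_elim (blast intro: order_trans[OF norm_sum])
      qed
    qed
  qed
qed

end
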